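(* Let $\mathcal B=(e_n)_{n=1}^\infty$ be a basis of a real Banach space $\mathbb X$ and let $w$ be a weight. (a) If $\mathcal B$ is $C_g$-$w$-greedy, then $\mathcal B$ is $K_u$-unconditional and has the $C_a$-$w$-Property (A), with constants $K_u\le C_g$ and $C_a\le C_g$. (b) If $\mathcal B$ is $K_u$-unconditional and has the $C_a$-$w$-Property (A), then $\mathcal B$ is $C_g$-$w$-greedy with $C_g\le K_uC_a$.
   Context: Basis: a Schauder basis $\mathcal B=(e_n)_{n=1}^\infty$ of a real Banach space $\mathbb X$ with biorthogonal functionals $(e_n^* )_{n=1}^\infty$ such that $0<\inf_n\min\{\|e_n\|,\|e_n^*\|\}\le\sup_n\max\{\|e_n\|,\|e_n^*\|\}<\infty$. For $x\in\mathbb X$, $\mathrm{supp}(x)=\{i\in\mathbb N: e_i^*(x)\neq0\}$. $\mathbb N^{<\infty}$ is the family of finite subsets of $\mathbb N$. $P_A(x)=\sum_{j\in A}e_j^*(x)e_j$ (for infinite $A$, convergence of the series is part of the requirement). For signs $\varepsilon=(\varepsilon_n)$, $\varepsilon_n\in\{\pm1\}$, and finite $A$, $\mathbf 1_{\varepsilon A}=\sum_{n\in A}\varepsilon_ne_n$. A weight is a sequence $w=(w_i)_{i=1}^\infty\in(0,\infty)^{\mathbb N}$; $w(A)=\sum_{i\in A}w_i$. A greedy set of $x$ of cardinality $m\in\mathbb N$ is a set $A_m(x)\subset\mathrm{supp}(x)$ with $|A_m(x)|=m$ and $\min_{k\in A_m(x)}|e_k^*(x)|\ge\sup_{k\notin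 A_m(x)}|e_k^*(x)|$; the corresponding greedy approximand is $\mathcal G_m(x)=P_{A_m(x)}(x)$. Inequalities involving $\mathcal G_m(x)$, $A_m(x)$ are required for every choice of greedy set. $\mathcal B$ is $w$-greedy if there is $C\ge1$ such that $\|x-\mathcal G_m(x)\|\le C\,\sigma^w_{w(A_m(x))}(x)$ for all $x\in\mathbb X$, $m\in\mathbb N$, where $\sigma^w_\delta(x)=\inf\{\|x-\sum_{n\in A}a_ne_n\|: A\in\mathbb N^{<\infty},\ w(A)\le\delta,\ a_n\in\mathbb R\}$; the least such $C$ is $C_g$ and $\mathcal B$ is then called $C_g$-$w$-greedy. $\mathcal B$ is unconditional if there is $K$ with $\|x-P_A(x)\|\le K\|x\|$ for all $x\in\mathbb X$ and all $A\subset\mathbb N$; the least such $K$ is $K_u$ and $\mathcal B$ is then called $K_u$-unconditional. $\mathcal B$ has the $w$-Property (A) if there is $C\ge1$ such that $\|x+t\mathbf 1_{\varepsilon A}\|\le C\|x+t\mathbf 1_{\eta B}\|$ for all $x\in\mathbb X$, all $A,B\in\mathbb N^{<\infty}$ with $w(A)\le w(B)$, $A\cap B=\emptyset$, $\mathrm{supp}(x)\cap(A\cup B)=\emptyset$, all signs $\varepsilon,\eta$, and all $t\ge\sup_j|e_j^*(x)|$; the least such $C$ is $C_a$ and $\mathcal B$ is then said to have the $C_a$-$w$-Property (A). *)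

theory Defs
  imports "HOL-Analysis.Analysis"
begin

definition schauder_basis :: "(nat \<Rightarrow> 'a::banach) \<Rightarrow> bool" where
  "schauder_basis e \<longleftrightarrow> (\<forall>x. \<exists>!a::nat \<Rightarrow> real. (\<lambda>n. a n *\<^sub>R e n) sums x)"

definition biorthogonal :: "(nat \<Rightarrow> 'a::banach) \<Rightarrow> (nat \<Rightarrow> 'a \<Rightarrow>\<^sub>L real) \<Rightarrow> bool" where
  "biorthogonal e es \<longleftrightarrow> (\<forall>m n. blinfun_apply (es n) (e m) = (if m = n then 1 else 0))"

text \<open>
  Sequences are indexed from 0. For a Schauder basis \<open>e\<close> the family \<open>es\<close> of bounded
  functionals exists and is determined by biorthogonality, so \<open>es\<close> is not additional data;
  \<open>norm (es n)\<close> is the dual norm. The condition \<open>bdd_above\<close> says that the supremum is finite.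
\<close>

definition basis :: "(nat \<Rightarrow> 'a::banach) \<Rightarrow> (nat \<Rightarrow> 'a \<Rightarrow>\<^sub>L real) \<Rightarrow> bool" where
  "basis e es \<longleftrightarrow> schauder_basis e \<and> biorthogonal e es \<and>
     0 < (INF n. min (norm (e n)) (norm (es n))) \<and>
     bdd_above (range (\<lambda>n. max (norm (e n)) (norm (es n))))"

definition weight :: "(nat \<Rightarrow> real) \<Rightarrow> bool" where
  "weight w \<longleftrightarrow> (\<forall>n. 0 < w n)"

definition supp :: "(nat \<Rightarrow> 'a::banach \<Rightarrow>\<^sub>L real) \<Rightarrow> 'a \<Rightarrow> nat set" where
  "supp es x = {i. blinfun_apply (es i) x \<noteq> 0}"

definition proj_summable ::
    "(nat \<Rightarrow> 'a::banach) \<Rightarrow> (nat \<Rightarrow> 'a \<Rightarrow>\<^sub>L real) \<Rightarrow> nat set \<Rightarrow> 'a \<Rightarrow> bool" where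
  "proj_summable e es A x \<longleftrightarrow>
     summable (\<lambda>j. if j \<in> A then blinfun_apply (es j) x *\<^sub>R e j else 0)"

text \<open>For infinite \<open>A\<close> the value is meaningful only if \<open>proj_summable e es A x\<close> holds.\<close>

definition proj :: "(nat \<Rightarrow> 'a::banach) \<Rightarrow> (nat \<Rightarrow> 'a \<Rightarrow>\<^sub>L real) \<Rightarrow> nat set \<Rightarrow> 'a \<Rightarrow> 'a" where
  "proj e es A x = (\<Sum>j. if j \<in> A then blinfun_apply (es j) x *\<^sub>R e j else 0)"

lemma proj_finite:
  assumes "finite A"
  shows "proj_summable e es A x" "proj e es A x = (\<Sum>j\<in>A. blinfun_apply (es j) x *\<^sub>R e j)"
  using sums_If_finite_set[OF assms, of "\<lambda>j. blinfun_apply (es j) x *\<^sub>R e j"]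
  by (auto simp: proj_summable_def proj_def dest: sums_summable sums_unique)

definition signs :: "(nat \<Rightarrow> real) \<Rightarrow> bool" where
  "signs \<epsilon> \<longleftrightarrow> (\<forall>n. \<epsilon> n \<in> {-1, 1})"

definition sign_sum :: "(nat \<Rightarrow> 'a::banach) \<Rightarrow> (nat \<Rightarrow> real) \<Rightarrow> nat set \<Rightarrow> 'a" where
  "sign_sum e \<epsilon> A = (\<Sum>n\<in>A. \<epsilon> n *\<^sub>R e n)"

definition greedy_set :: "(nat \<Rightarrow> 'a::banach \<Rightarrow>\<^sub>L real) \<Rightarrow> 'a \<Rightarrow> nat \<Rightarrow> nat set \<Rightarrow> bool" where
  "greedy_set es x m A \<longleftrightarrow> finite A \<and> A \<subseteq> supp es x \<and> card A = m \<and>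
     (SUP k\<in>-A. \<bar>blinfun_apply (es k) x\<bar>) \<le> Min ((\<lambda>k. \<bar>blinfun_apply (es k) x\<bar>) ` A)"

definition sigma_w ::
    "(nat \<Rightarrow> 'a::banach) \<Rightarrow> (nat \<Rightarrow> real) \<Rightarrow> real \<Rightarrow> 'a \<Rightarrow> real" where
  "sigma_w e w \<delta> x =
     Inf {norm (x - (\<Sum>n\<in>A. a n *\<^sub>R e n)) | A (a :: nat \<Rightarrow> real). finite A \<and> sum w A \<le> \<delta>}"

definition w_greedy_with ::
    "(nat \<Rightarrow> 'a::banach) \<Rightarrow> (nat \<Rightarrow> 'a \<Rightarrow>\<^sub>L real) \<Rightarrow> (nat \<Rightarrow> real) \<Rightarrow> real \<Rightarrow> bool" where
  "w_greedy_with e es w C \<longleftrightarrow> 1 \<le> C \<and>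
     (\<forall>x m A. 1 \<le> m \<longrightarrow> greedy_set es x m A \<longrightarrow>
        norm (x - proj e es A x) \<le> C * sigma_w e w (sum w A) x)"

definition w_greedy ::
    "(nat \<Rightarrow> 'a::banach) \<Rightarrow> (nat \<Rightarrow> 'a \<Rightarrow>\<^sub>L real) \<Rightarrow> (nat \<Rightarrow> real) \<Rightarrow> bool" where
  "w_greedy e es w \<longleftrightarrow> (\<exists>C. w_greedy_with e es w C)"

definition C_g ::
    "(nat \<Rightarrow> 'a::banach) \<Rightarrow> (nat \<Rightarrow> 'a \<Rightarrow>\<^sub>L real) \<Rightarrow> (nat \<Rightarrow> real) \<Rightarrow> real" where
  "C_g e es w = (LEAST C. w_greedy_with e es w C)"

definition unconditional_with ::
    "(nat \<Rightarrow> 'a::banach) \<Rightarrow> (nat \<Rightarrow> 'a \<Rightarrow>\<^sub>L real) \<Rightarrow> real \<Rightarrow> bool" where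
  "unconditional_with e es K \<longleftrightarrow>
     (\<forall>x A. proj_summable e es A x \<and> norm (x - proj e es A x) \<le> K * norm x)"

definition unconditional ::
    "(nat \<Rightarrow> 'a::banach) \<Rightarrow> (nat \<Rightarrow> 'a \<Rightarrow>\<^sub>L real) \<Rightarrow> bool" where
  "unconditional e es \<longleftrightarrow> (\<exists>K. unconditional_with e es K)"

definition K_u :: "(nat \<Rightarrow> 'a::banach) \<Rightarrow> (nat \<Rightarrow> 'a \<Rightarrow>\<^sub>L real) \<Rightarrow> real" where
  "K_u e es = (LEAST K. unconditional_with e es K)"

definition w_property_A_with ::
    "(nat \<Rightarrow> 'a::banach) \<Rightarrow> (nat \<Rightarrow> 'a \<Rightarrow>\<^sub>L real) \<Rightarrow> (nat \<Rightarrow> real) \<Rightarrow> real \<Rightarrow> bool" where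
  "w_property_A_with e es w C \<longleftrightarrow> 1 \<le> C \<and>
     (\<forall>x A B \<epsilon> \<eta> t. finite A \<longrightarrow> finite B \<longrightarrow> sum w A \<le> sum w B \<longrightarrow> A \<inter> B = {} \<longrightarrow>
        supp es x \<inter> (A \<union> B) = {} \<longrightarrow> signs \<epsilon> \<longrightarrow> signs \<eta> \<longrightarrow>
        (SUP j. \<bar>blinfun_apply (es j) x\<bar>) \<le> t \<longrightarrow>
        norm (x + t *\<^sub>R sign_sum e \<epsilon> A) \<le> C * norm (x + t *\<^sub>R sign_sum e \<eta> B))"

definition w_property_A ::
    "(nat \<Rightarrow> 'a::banach) \<Rightarrow> (nat \<Rightarrow> 'a \<Rightarrow>\<^sub>L real) \<Rightarrow> (nat \<Rightarrow> real) \<Rightarrow> bool" where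
  "w_property_A e es w \<longleftrightarrow> (\<exists>C. w_property_A_with e es w C)"

definition C_a ::
    "(nat \<Rightarrow> 'a::banach) \<Rightarrow> (nat \<Rightarrow> 'a \<Rightarrow>\<^sub>L real) \<Rightarrow> (nat \<Rightarrow> real) \<Rightarrow> real" where
  "C_a e es w = (LEAST C. w_property_A_with e es w C)"

text \<open>
  The least constants are attained. Likewise, the suprema over coefficients are taken over
  bounded sets, so the values of \<open>LEAST\<close> and \<open>SUP\<close> above are never underspecified.
\<close>

lemma Least_closed_real:
  fixes P :: "real \<Rightarrow> bool"
  assumes "P c" and "\<And>x. P x \<Longrightarrow> l \<le> x" and "closed {x. P x}"
  shows "P (LEAST x. P x)" "\<And>x. P x \<Longrightarrow> (LEAST x. P x) \<le> x"
proof -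
  have bdd: "bdd_below {x. P x}" using assms(2) by (intro bdd_belowI[of _ l]) auto
  have in_set: "Inf {x. P x} \<in> {x. P x}"
    by (rule closed_contains_Inf) (use assms bdd in auto)
  have lower: "Inf {x. P x} \<le> x" if "P x" for x
    using bdd that by (auto intro: cInf_lower)
  have "(LEAST x. P x) = Inf {x. P x}"
    by (rule Least_equality) (use in_set lower in auto)
  then show "P (LEAST x. P x)" "\<And>x. P x \<Longrightarrow> (LEAST x. P x) \<le> x"
    using in_set lower by auto
qed

lemma C_g_least:
  assumes "w_greedy e es w"
  shows "w_greedy_with e es w (C_g e es w)" "w_greedy_with e es w C \<Longrightarrow> C_g e es w \<le> C"
proof -
  obtain c where c: "w_greedy_with e es w c" using assms by (auto simp: w_greedy_def)
  have cl: "closed {C. w_greedy_with e es w C}"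
    unfolding w_greedy_with_def
    by (intro closed_Collect_conj closed_Collect_all closed_Collect_imp closed_Collect_le
        open_Collect_const continuous_intros)
  have ge: "1 \<le> C" if "w_greedy_with e es w C" for C
    using that by (simp add: w_greedy_with_def)
  note L = Least_closed_real[of "w_greedy_with e es w", OF c ge cl]
  show "w_greedy_with e es w (C_g e es w)" "w_greedy_with e es w C \<Longrightarrow> C_g e es w \<le> C"
    unfolding C_g_def using L by auto
qed

lemma C_a_least:
  assumes "w_property_A e es w"
  shows "w_property_A_with e es w (C_a e es w)" "w_property_A_with e es w C \<Longrightarrow> C_a e es w \<le> C"
proof -
  obtain c where c: "w_property_A_with e es w c" using assms by (auto simp: w_property_A_def)
  have cl: "closed {C. w_property_A_with e es w C}"
    unfolding w_property_A_with_def
    by (intro closed_Collect_conj closed_Collect_all closed_Collect_imp closed_Collect_le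
        open_Collect_const continuous_intros)
  have ge: "1 \<le> C" if "w_property_A_with e es w C" for C
    using that by (simp add: w_property_A_with_def)
  note L = Least_closed_real[of "w_property_A_with e es w", OF c ge cl]
  show "w_property_A_with e es w (C_a e es w)"
    "w_property_A_with e es w C \<Longrightarrow> C_a e es w \<le> C"
    unfolding C_a_def using L by auto
qed

lemma K_u_least:
  assumes "basis e es" "unconditional e es"
  shows "unconditional_with e es (K_u e es)" "unconditional_with e es K \<Longrightarrow> K_u e es \<le> K"
proof -
  obtain c where c: "unconditional_with e es c" using assms by (auto simp: unconditional_def)
  have cl: "closed {K. unconditional_with e es K}"
    unfolding unconditional_with_def
    by (intro closed_Collect_conj closed_Collect_all closed_Collect_le closed_Collect_const
        continuous_intros)
  have "blinfun_apply (es 0) (e 0) = 1"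
    using assms(1) by (auto simp: basis_def biorthogonal_def)
  then have e0: "0 < norm (e 0)" by (auto simp: blinfun.zero_right)
  have ge: "1 \<le> K" if "unconditional_with e es K" for K
  proof -
    have "norm (e 0 - proj e es {} (e 0)) \<le> K * norm (e 0)"
      using that by (auto simp: unconditional_with_def)
    then show ?thesis using e0 by (simp add: proj_def)
  qed
  note L = Least_closed_real[of "unconditional_with e es", OF c ge cl]
  show "unconditional_with e es (K_u e es)" "unconditional_with e es K \<Longrightarrow> K_u e es \<le> K"
    unfolding K_u_def using L by auto
qed

lemma coeffs_bdd_above:
  assumes "basis e es"
  shows "bdd_above ((\<lambda>k. \<bar>blinfun_apply (es k) x\<bar>) ` A)"
proof -
  obtain M where M: "\<And>n. max (norm (e n)) (norm (es n)) \<le> M"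
    using assms by (auto simp: basis_def bdd_above_def)
  have "\<bar>blinfun_apply (es k) x\<bar> \<le> M * norm x" for k
  proof -
    have "\<bar>blinfun_apply (es k) x\<bar> \<le> norm (es k) * norm x"
      using norm_blinfun[of "es k" x] by simp
    also have "\<dots> \<le> M * norm x" using M[of k] by (intro mult_right_mono) auto
    finally show ?thesis .
  qed
  then show ?thesis by (intro bdd_aboveI[of _ "M * norm x"]) auto
qed

end

theory Submission
  imports Defs
begin

text \<open>
  Both directions compare constants for each fixed value of the constant; the inequalities between
  the least constants then follow because these are attained.

  From greedy to unconditional and Property (A): if the nonzero coefficients on a nonempty finite set \<open>A\<close>
  dominate all the others, then \<open>A\<close> is a greedy set, so \<open>w\<close>-greediness bounds the removal of
  the part on \<open>A\<close> by the removal of \<^emph>\<open>any\<close> combination over a set of no larger weight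
  (\<open>w_greedy_with_dominating\<close>). To obtain the projection bound for \<open>x\<close>, add a huge multiple
  of the indicator sum of \<open>A\<close> to \<open>x\<close>: removing \<open>A\<close> greedily leaves \<open>x - P\<^sub>A x\<close>, while removing
  just the added multiple leaves \<open>x\<close>. To obtain Property (A), apply the same principle to
  \<open>x + t 1\<^bsub>\<epsilon>A\<^esub> + t 1\<^bsub>\<eta>B\<^esub>\<close>, in which \<open>B\<close> is a greedy set and
  \<open>A\<close> competes with it. Bounds on finite projections extend to infinite sets because the
  tails of the basis expansion are small (\<open>unconditional_withI_finite\<close>).

  Conversely, let \<open>A\<close> be a greedy set of \<open>x\<close>, let \<open>y = x - \<Sum>\<^bsub>n\<in>B\<^esub> a\<^sub>n e\<^sub>n\<close> be a
  competitor with \<open>w(B) \<le> w(A)\<close>, let \<open>t\<close> be the least modulus of a coefficient of \<open>x\<close> on \<open>A\<close>, and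
  let \<open>z\<close> be \<open>x\<close> with the part on \<open>A \<union> B\<close> removed. Then \<open>x - P\<^sub>A x\<close> is \<open>z\<close> plus a vector on
  \<open>B - A\<close> with coefficients bounded by \<open>t\<close>, hence an average of the vectors
  \<open>z + t 1\<^bsub>\<epsilon>(B-A)\<^esub>\<close>. Property (A) moves these to \<open>z + t 1\<^bsub>\<eta>(A-B)\<^esub>\<close> at the cost of
  \<open>C\<^sub>a\<close>, where \<open>\<eta>\<close> are the signs of \<open>x\<close>. The latter vector arises from \<open>y\<close> by multiplying finitely
  many coefficients by factors in \<open>[0,1]\<close>, so it is an average of vectors \<open>y - P\<^sub>F y\<close> and its
  norm is at most \<open>K\<^sub>u \<parallel>y\<parallel>\<close>. Treating both truncations as averages
  (\<open>norm_diff_scaled_sum_le\<close>) is what makes the constant exactly \<open>K\<^sub>u C\<^sub>a\<close>.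
\<close>

section \<open>Coefficients and basis expansions\<close>

lemma coeff_finite_sum:
  assumes "biorthogonal e es" "finite A"
  shows "blinfun_apply (es k) (\<Sum>n\<in>A. a n *\<^sub>R e n) = (if k \<in> A then a k else 0)"
proof -
  have "blinfun_apply (es k) (\<Sum>n\<in>A. a n *\<^sub>R e n) = (\<Sum>n\<in>A. if k = n then a n else 0)"
    using assms(1)
    by (auto simp: blinfun.sum_right blinfun.scaleR_right biorthogonal_def intro!: sum.cong)
  then show ?thesis using assms(2) by simp
qed

lemma basis_vector_nonzero:
  assumes "biorthogonal e es"
  shows "e n \<noteq> 0"
proof
  assume "e n = 0"
  moreover have "blinfun_apply (es n) (e n) = 1" using assms by (simp add: biorthogonal_def)
  ultimately show False by (simp add: blinfun.zero_right)
qed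

lemma basis_biorthogonal: "basis e es \<Longrightarrow> biorthogonal e es"
  by (simp add: basis_def)

lemma basis_expansion_sums:
  assumes "basis e es"
  shows "(\<lambda>n. blinfun_apply (es n) x *\<^sub>R e n) sums x"
proof -
  obtain a :: "nat \<Rightarrow> real" where a: "(\<lambda>n. a n *\<^sub>R e n) sums x"
    using assms unfolding basis_def schauder_basis_def by blast
  have "blinfun_apply (es k) x = a k" for k
  proof -
    have "(\<lambda>n. blinfun_apply (es k) (a n *\<^sub>R e n)) sums blinfun_apply (es k) x"
      using a by (rule bounded_linear.sums[OF blinfun.bounded_linear_right])
    moreover have "(\<lambda>n. blinfun_apply (es k) (a n *\<^sub>R e n)) = (\<lambda>n. if n = k then a n else 0)"
      using basis_biorthogonal[OF assms]
      by (auto simp: biorthogonal_def blinfun.scaleR_right)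
    ultimately show ?thesis
      using sums_single[of k a] sums_unique2 by metis
  qed
  then show ?thesis using a by simp
qed

lemma coeff_le_SUP:
  assumes "basis e es" "k \<in> A"
  shows "\<bar>blinfun_apply (es k) x\<bar> \<le> (SUP j\<in>A. \<bar>blinfun_apply (es j) x\<bar>)"
  using cSUP_upper[OF assms(2) coeffs_bdd_above[OF assms(1)]] .

section \<open>Averages of vectors with coefficients removed\<close>

text \<open>
  With \<open>\<mu>\<^sub>n \<in> [0,1]\<close>, the vector \<open>y - \<Sum> \<mu>\<^sub>n v\<^sub>n\<close> lies in the convex hull of the vectors
  \<open>y - \<Sum>\<^bsub>n\<in>F\<^esub> v\<^sub>n\<close>, the vertices of a parallelepiped; the induction treats one edge direction
  at a time.
\<close>

lemma norm_diff_scaled_sum_le: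
  fixes v :: "'i \<Rightarrow> 'a::real_normed_vector"
  assumes "finite S" "\<And>n. n \<in> S \<Longrightarrow> 0 \<le> \<mu> n \<and> \<mu> n \<le> 1"
    and "\<And>F. F \<subseteq> S \<Longrightarrow> norm (y - (\<Sum>n\<in>F. v n)) \<le> M"
  shows "norm (y - (\<Sum>n\<in>S. \<mu> n *\<^sub>R v n)) \<le> M"
  using assms
proof (induction S arbitrary: y rule: finite_induct)
  case empty
  then show ?case by fastforce
next
  case (insert s S)
  have without: "norm (y - (\<Sum>n\<in>S. \<mu> n *\<^sub>R v n)) \<le> M"
    using insert.prems by (intro insert.IH) blast+
  have with_s: "norm (y - v s - (\<Sum>n\<in>S. \<mu> n *\<^sub>R v n)) \<le> M"
  proof (intro insert.IH)
    fix F assume F: "F \<subseteq> S"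
    then have "finite F" "s \<notin> F" using insert.hyps finite_subset by auto
    then have "y - v s - (\<Sum>n\<in>F. v n) = y - (\<Sum>n\<in>insert s F. v n)" by simp
    then show "norm (y - v s - (\<Sum>n\<in>F. v n)) \<le> M"
      using insert.prems(2)[of "insert s F"] F by (simp only: insert_mono)
  qed (use insert.prems(1) in blast)
  let ?u = "y - (\<Sum>n\<in>S. \<mu> n *\<^sub>R v n)"
  have \<mu>: "0 \<le> \<mu> s" "\<mu> s \<le> 1" using insert.prems(1) by auto
  have "y - (\<Sum>n\<in>insert s S. \<mu> n *\<^sub>R v n) = (1 - \<mu> s) *\<^sub>R ?u + \<mu> s *\<^sub>R (?u - v s)"
    using insert.hyps by (simp add: algebra_simps)
  also have "norm \<dots> \<le> (1 - \<mu> s) * norm ?u + \<mu> s * norm (?u - v s)"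
    by (rule norm_triangle_le) (use \<mu> in simp)
  also have "\<dots> \<le> (1 - \<mu> s) * M + \<mu> s * M"
    using \<mu> without with_s by (intro add_mono mult_left_mono) (auto simp: algebra_simps)
  finally show ?case by (simp add: algebra_simps)
qed

text \<open>
  A number of modulus at most \<open>t\<close> is an average of \<open>t\<close> and \<open>-t\<close>: starting from the vector with
  all coefficients \<open>t\<close>, removing \<open>2t e\<^sub>n\<close> flips the sign at \<open>n\<close>, so the preceding lemma applies.
\<close>

lemma norm_add_bounded_coeffs_le:
  assumes "finite S" "\<And>n. n \<in> S \<Longrightarrow> \<bar>b n\<bar> \<le> t"
    and "\<And>\<epsilon>. signs \<epsilon> \<Longrightarrow> norm (z + t *\<^sub>R sign_sum e \<epsilon> S) \<le> M"
  shows "norm (z + (\<Sum>n\<in>S. b n *\<^sub>R e n)) \<le> M"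
proof (cases "t = 0")
  case True
  then show ?thesis using assms(2) assms(3)[of "\<lambda>_. 1"] by (simp add: signs_def)
next
  case False
  show ?thesis
  proof (cases "S = {}")
    case True
    then show ?thesis using assms(3)[of "\<lambda>_. 1"] by (simp add: signs_def sign_sum_def)
  next
    case False
    then have "0 \<le> t" using assms(2) by fastforce
    with \<open>t \<noteq> 0\<close> have t: "0 < t" by simp
    have "norm ((z + t *\<^sub>R sign_sum e (\<lambda>_. 1) S)
        - (\<Sum>n\<in>S. ((t - b n) / (2 * t)) *\<^sub>R ((2 * t) *\<^sub>R e n))) \<le> M"
    proof (rule norm_diff_scaled_sum_le[OF assms(1)])
      fix n assume "n \<in> S"
      then show "0 \<le> (t - b n) / (2 * t) \<and> (t - b n) / (2 * t) \<le> 1"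
        using assms(2)[of n] t by (auto simp: divide_simps)
    next
      fix F assume F: "F \<subseteq> S"
      let ?\<epsilon> = "\<lambda>n. if n \<in> F then - 1 else 1 :: real"
      have "(\<Sum>n\<in>F. (2 * t) *\<^sub>R e n) = (\<Sum>n\<in>S. if n \<in> F then (2 * t) *\<^sub>R e n else 0)"
        using F assms(1) by (simp add: sum.inter_restrict[symmetric] Int_absorb1)
      then have "z + t *\<^sub>R sign_sum e (\<lambda>_. 1) S - (\<Sum>n\<in>F. (2 * t) *\<^sub>R e n)
          = z + t *\<^sub>R sign_sum e ?\<epsilon> S"
        unfolding sign_sum_def scaleR_sum_right
        by (simp add: add_diff_eq[symmetric] sum_subtractf[symmetric])
          (intro sum.cong, auto simp: scaleR_left_diff_distrib[symmetric])
      then show "norm (z + t *\<^sub>R sign_sum e (\<lambda>_. 1) S - (\<Sum>n\<in>F. (2 * t) *\<^sub>R e n)) \<le> M"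
        using assms(3)[of ?\<epsilon>] by (simp only: signs_def) simp
    qed
    also have "(z + t *\<^sub>R sign_sum e (\<lambda>_. 1) S)
        - (\<Sum>n\<in>S. ((t - b n) / (2 * t)) *\<^sub>R ((2 * t) *\<^sub>R e n)) = z + (\<Sum>n\<in>S. b n *\<^sub>R e n)"
      using t unfolding sign_sum_def scaleR_sum_right
      by (simp add: add_diff_eq[symmetric] sum_subtractf[symmetric]
          scaleR_left_diff_distrib[symmetric])
    finally show ?thesis .
  qed
qed

section \<open>Consequences of the greedy inequality\<close>

lemma sigma_w_le:
  assumes "finite D" "sum w D \<le> \<delta>"
  shows "sigma_w e w \<delta> x \<le> norm (x - (\<Sum>n\<in>D. a n *\<^sub>R e n))"
  unfolding sigma_w_def
  by (rule cInf_lower) (use assms in \<open>auto intro!: bdd_belowI[of _ 0]\<close>)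

text \<open>
  The positive threshold \<open>r\<close> separates the coefficients on \<open>A\<close> from the others and keeps \<open>A\<close>
  inside the support, so \<open>A\<close> is a greedy set.
\<close>

lemma w_greedy_with_dominating:
  assumes "w_greedy_with e es w C" "finite A" "A \<noteq> {}" "0 < r"
    and "\<And>k. k \<in> A \<Longrightarrow> r \<le> \<bar>blinfun_apply (es k) y\<bar>"
    and "\<And>k. k \<notin> A \<Longrightarrow> \<bar>blinfun_apply (es k) y\<bar> \<le> r"
    and "finite D" "sum w D \<le> sum w A"
  shows "norm (y - (\<Sum>n\<in>A. blinfun_apply (es n) y *\<^sub>R e n))
    \<le> C * norm (y - (\<Sum>n\<in>D. a n *\<^sub>R e n))"
proof -
  have "- A \<noteq> {}" using finite_compl[OF assms(2)] infinite_UNIV_nat by auto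
  then have "(SUP k\<in>-A. \<bar>blinfun_apply (es k) y\<bar>) \<le> r"
    using assms(6) by (intro cSUP_least) auto
  also have "r \<le> Min ((\<lambda>k. \<bar>blinfun_apply (es k) y\<bar>) ` A)"
    using assms by (subst Min_ge_iff) auto
  finally have "greedy_set es y (card A) A"
    using assms unfolding greedy_set_def supp_def by force
  moreover have "1 \<le> card A"
    using assms(2,3) by (simp add: Suc_le_eq card_gt_0_iff)
  ultimately have "norm (y - proj e es A y) \<le> C * sigma_w e w (sum w A) y"
    using assms(1) unfolding w_greedy_with_def by blast
  also have "\<dots> \<le> C * norm (y - (\<Sum>n\<in>D. a n *\<^sub>R e n))"
    using assms(1) sigma_w_le[OF assms(7,8)] by (intro mult_left_mono) (auto simp: w_greedy_with_def)
  finally show ?thesis using proj_finite(2)[OF assms(2)] by metis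
qed

lemma w_greedy_with_finite_projection:
  assumes "basis e es" "w_greedy_with e es w C" "finite A"
  shows "norm (x - (\<Sum>n\<in>A. blinfun_apply (es n) x *\<^sub>R e n)) \<le> C * norm x"
proof (cases "A = {}")
  case True
  have "1 \<le> C" using assms(2) by (simp add: w_greedy_with_def)
  then show ?thesis using True mult_right_mono[of 1 C "norm x"] by simp
next
  case False
  let ?c = "\<lambda>k. blinfun_apply (es k)"
  define r where "r = 1 + (SUP j. \<bar>?c j x\<bar>)"
  have c_less: "\<bar>?c k x\<bar> < r" for k
    using coeff_le_SUP[OF assms(1), of k UNIV x] by (simp add: r_def)
  have r: "0 < r" using c_less[of 0] by linarith
  \<comment> \<open>The shift \<open>2r\<close> lifts the coefficients on \<open>A\<close> above \<open>r\<close>, whatever their signs.\<close>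
  define y where "y = x + (\<Sum>n\<in>A. (2 * r) *\<^sub>R e n)"
  have cy: "?c k y = ?c k x + (if k \<in> A then 2 * r else 0)" for k
    unfolding y_def
    using coeff_finite_sum[OF basis_biorthogonal[OF assms(1)] assms(3), of k "\<lambda>_. 2 * r"]
    by (simp add: blinfun.add_right)
  have "norm (y - (\<Sum>n\<in>A. ?c n y *\<^sub>R e n)) \<le> C * norm (y - (\<Sum>n\<in>A. (2 * r) *\<^sub>R e n))"
  proof (rule w_greedy_with_dominating[OF assms(2,3) False r _ _ assms(3)])
    fix k assume "k \<in> A"
    then show "r \<le> \<bar>?c k y\<bar>" using c_less[of k] by (simp add: cy)
  next
    fix k assume "k \<notin> A"
    then show "\<bar>?c k y\<bar> \<le> r" using c_less[of k] by (simp add: cy)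
  qed simp
  moreover have "y - (\<Sum>n\<in>A. ?c n y *\<^sub>R e n) = x - (\<Sum>n\<in>A. ?c n x *\<^sub>R e n)"
    unfolding cy by (simp add: y_def scaleR_left_distrib sum.distrib)
  moreover have "y - (\<Sum>n\<in>A. (2 * r) *\<^sub>R e n) = x" by (simp add: y_def)
  ultimately show ?thesis by metis
qed

text \<open>
  Applying the finite bound to a tail \<open>x - S\<^sub>N x\<close> shows that all finite blocks of the expansion
  beyond \<open>N\<close> are small, which is the Cauchy criterion for \<open>P\<^sub>A x\<close>; the bound passes to the limit.
\<close>

lemma unconditional_withI_finite:
  assumes "basis e es"
    and fin: "\<And>x A. finite A \<Longrightarrow>
      norm (x - (\<Sum>n\<in>A. blinfun_apply (es n) x *\<^sub>R e n)) \<le> C * norm x"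
  shows "unconditional_with e es C"
  unfolding unconditional_with_def
proof (intro allI conjI)
  fix x :: 'a and A :: "nat set"
  let ?c = "\<lambda>k. blinfun_apply (es k)"
  let ?f = "\<lambda>j. if j \<in> A then ?c j x *\<^sub>R e j else 0"
  have f_sum: "(\<Sum>j\<in>I. ?f j) = (\<Sum>n\<in>A \<inter> I. ?c n x *\<^sub>R e n)" if "finite I" for I
    using that by (simp add: sum.inter_restrict[symmetric] Int_commute)
  have "norm (e 0) \<le> C * norm (e 0)" using fin[of "{}" "e 0"] by simp
  then have C: "0 \<le> C"
    using basis_vector_nonzero[OF basis_biorthogonal[OF assms(1)], of 0] by simp
  have "summable ?f"
  proof (subst summable_Cauchy, intro allI impI)
    fix \<epsilon> :: real assume \<epsilon>: "0 < \<epsilon>"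
    let ?tail = "\<lambda>N. x - (\<Sum>j<N. ?c j x *\<^sub>R e j)"
    obtain N where N: "norm (?tail N) < \<epsilon> / (1 + C)"
    proof -
      have "(\<lambda>N. \<Sum>j<N. ?c j x *\<^sub>R e j) \<longlonglongrightarrow> x"
        using basis_expansion_sums[OF assms(1)] by (simp add: sums_def)
      moreover have "0 < \<epsilon> / (1 + C)" using \<epsilon> C by simp
      ultimately show ?thesis
        using that LIMSEQ_D[of _ x "\<epsilon> / (1 + C)"] by (auto simp: norm_minus_commute)
    qed
    have "norm (sum ?f {m..<n}) < \<epsilon>" if "N \<le> m" for m n
    proof -
      let ?F = "A \<inter> {m..<n}"
      have "?c k (?tail N) = ?c k x" if "k \<in> ?F" for k
        using that \<open>N \<le> m\<close> coeff_finite_sum[OF basis_biorthogonal[OF assms(1)], of "{..<N}"]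
        by (simp add: blinfun.diff_right)
      then have "sum ?f {m..<n} = (\<Sum>k\<in>?F. ?c k (?tail N) *\<^sub>R e k)"
        by (simp add: f_sum)
      also have "norm \<dots> \<le> norm (?tail N) + C * norm (?tail N)"
      proof -
        have "norm u \<le> norm v + norm (v - u)" for u v :: 'a
          using norm_triangle_sub[of u v] by (simp add: norm_minus_commute)
        then show ?thesis by (rule order_trans) (rule add_left_mono, rule fin, simp)
      qed
      also have "\<dots> < \<epsilon>" using N C by (simp add: field_simps)
      finally show ?thesis .
    qed
    then show "\<exists>N. \<forall>m\<ge>N. \<forall>n. norm (sum ?f {m..<n}) < \<epsilon>" by blast
  qed
  then show "proj_summable e es A x" by (simp add: proj_summable_def)
  have "(\<lambda>n. norm (x - (\<Sum>j<n. ?f j))) \<longlonglongrightarrow> norm (x - proj e es A x)"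
    unfolding proj_def using summable_LIMSEQ[OF \<open>summable ?f\<close>] by (intro tendsto_intros)
  then show "norm (x - proj e es A x) \<le> C * norm x"
    by (rule LIMSEQ_le_const2) (use fin f_sum in auto)
qed

lemma w_greedy_with_imp_unconditional_with:
  assumes "basis e es" "w_greedy_with e es w C"
  shows "unconditional_with e es C"
  using unconditional_withI_finite[OF assms(1)] w_greedy_with_finite_projection[OF assms] by blast

lemma w_greedy_with_imp_w_property_A_with:
  assumes "basis e es" "weight w" "w_greedy_with e es w C"
  shows "w_property_A_with e es w C"
  unfolding w_property_A_with_def
proof (intro conjI allI impI)
  show C: "1 \<le> C" using assms(3) by (simp add: w_greedy_with_def)
  fix x A B \<epsilon> \<eta> t
  let ?c = "\<lambda>k. blinfun_apply (es k)"
  assume AB: "finite A" "finite B" "sum w A \<le> sum w B" "A \<inter> B = {}"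
    and supp_x: "supp es x \<inter> (A \<union> B) = {}" and sg: "signs \<epsilon>" "signs \<eta>"
    and t: "(SUP j. \<bar>?c j x\<bar>) \<le> t"
  have cx_le: "\<bar>?c k x\<bar> \<le> t" for k
    using coeff_le_SUP[OF assms(1), of k UNIV x] t by simp
  have cx0: "?c k x = 0" if "k \<in> A \<union> B" for k
    using supp_x that by (auto simp: supp_def)
  have abs_sg: "\<bar>\<epsilon> k\<bar> = 1" "\<bar>\<eta> k\<bar> = 1" for k
    using sg unfolding signs_def by (auto dest!: spec[of _ k])
  show "norm (x + t *\<^sub>R sign_sum e \<epsilon> A) \<le> C * norm (x + t *\<^sub>R sign_sum e \<eta> B)"
  proof (cases "t = 0 \<or> B = {}")
    case True
    have "t = 0 \<or> A = {} \<and> B = {}"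
    proof (cases "t = 0")
      case False
      \<comment> \<open>Weights are positive, so only the empty set has weight at most \<open>w(\<emptyset>) = 0\<close>.\<close>
      have "A = {}" if "sum w A \<le> 0"
        using that sum_pos[OF AB(1), of w] assms(2) unfolding weight_def by force
      then show ?thesis using True False AB(3) by simp
    qed simp
    then show ?thesis using C mult_right_mono[of 1 C "norm x"] by (auto simp: sign_sum_def)
  next
    case False
    then have t_pos: "0 < t" using cx_le[of 0] by linarith
    define y where "y = x + t *\<^sub>R sign_sum e \<epsilon> A + t *\<^sub>R sign_sum e \<eta> B"
    have cy: "?c k y = ?c k x + t * (if k \<in> A then \<epsilon> k else 0) + t * (if k \<in> B then \<eta> k else 0)"
      for k
      using coeff_finite_sum[OF basis_biorthogonal[OF assms(1)], of _ k] AB(1,2)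
      by (simp add: y_def sign_sum_def blinfun.add_right blinfun.scaleR_right)
    have "norm (y - (\<Sum>n\<in>B. ?c n y *\<^sub>R e n)) \<le> C * norm (y - (\<Sum>n\<in>A. (t * \<epsilon> n) *\<^sub>R e n))"
    proof (rule w_greedy_with_dominating[OF assms(3) AB(2) _ t_pos _ _ AB(1,3)])
      show "B \<noteq> {}" using False by simp
    next
      fix k assume "k \<in> B"
      moreover have "k \<notin> A" using \<open>k \<in> B\<close> AB(4) by blast
      ultimately show "t \<le> \<bar>?c k y\<bar>" using t_pos by (simp add: cy cx0 abs_mult abs_sg)
    next
      fix k assume "k \<notin> B"
      then show "\<bar>?c k y\<bar> \<le> t"
        using cx_le[of k] cx0[of k] t_pos by (cases "k \<in> A") (auto simp: cy abs_mult abs_sg)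
    qed
    moreover have "(\<Sum>n\<in>B. ?c n y *\<^sub>R e n) = t *\<^sub>R sign_sum e \<eta> B"
      unfolding sign_sum_def scaleR_sum_right using AB(4)
      by (intro sum.cong) (auto simp: cy cx0)
    moreover have "(\<Sum>n\<in>A. (t * \<epsilon> n) *\<^sub>R e n) = t *\<^sub>R sign_sum e \<epsilon> A"
      by (simp add: sign_sum_def scaleR_sum_right)
    ultimately show ?thesis by (simp add: y_def algebra_simps)
  qed
qed

section \<open>The greedy inequality from unconditionality and Property (A)\<close>

lemma unconditional_with_ge_1:
  assumes "basis e es" "unconditional_with e es K"
  shows "1 \<le> K"
proof -
  have "e 0 \<noteq> 0" using basis_vector_nonzero[OF basis_biorthogonal[OF assms(1)]] .
  moreover have "norm (e 0 - proj e es {} (e 0)) \<le> K * norm (e 0)"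
    using assms(2) by (simp add: unconditional_with_def)
  ultimately show ?thesis by (simp add: proj_def)
qed

text \<open>
  Multiplying finitely many coefficients by factors in \<open>[0,1]\<close> costs no more than removing coefficients.
\<close>

lemma unconditional_with_multiplier:
  assumes "unconditional_with e es K" "finite S" "\<And>n. n \<in> S \<Longrightarrow> 0 \<le> \<mu> n \<and> \<mu> n \<le> 1"
  shows "norm (y - (\<Sum>n\<in>S. \<mu> n *\<^sub>R (blinfun_apply (es n) y *\<^sub>R e n))) \<le> K * norm y"
proof (rule norm_diff_scaled_sum_le[OF assms(2,3)])
  fix F assume "F \<subseteq> S"
  then have "finite F" using assms(2) finite_subset by blast
  then show "norm (y - (\<Sum>n\<in>F. blinfun_apply (es n) y *\<^sub>R e n)) \<le> K * norm y"
    using assms(1) proj_finite(2)[of F e es y] unfolding unconditional_with_def by metis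
qed

text \<open>
  Property (A) exchanges \<open>B - A\<close> for \<open>A - B\<close> at the level \<open>t\<close> of the smallest coefficient on \<open>A\<close>;
  the averaging lemmas connect the two sides to \<open>x - P\<^sub>A x\<close> and to the competitor.
\<close>

lemma greedy_competitor_bound:
  assumes "basis e es" "unconditional_with e es K" "w_property_A_with e es w C"
    and "1 \<le> m" "greedy_set es x m A" "finite B" "sum w B \<le> sum w A"
  shows "norm (x - (\<Sum>n\<in>A. blinfun_apply (es n) x *\<^sub>R e n))
    \<le> K * C * norm (x - (\<Sum>n\<in>B. a n *\<^sub>R e n))"
proof -
  let ?c = "\<lambda>k. blinfun_apply (es k)"
  note biorth = basis_biorthogonal[OF assms(1)]
  have fin: "finite A" and A_supp: "A \<subseteq> supp es x" and "card A = m"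
    and sup_le: "(SUP k\<in>-A. \<bar>?c k x\<bar>) \<le> Min ((\<lambda>k. \<bar>?c k x\<bar>) ` A)"
    using assms(5) by (auto simp: greedy_set_def)
  have ne: "A \<noteq> {}" using \<open>card A = m\<close> assms(4) by auto
  define t where "t = Min ((\<lambda>k. \<bar>?c k x\<bar>) ` A)"
  have t_pos: "0 < t"
    using fin ne A_supp by (auto simp: t_def supp_def)
  have t_le: "t \<le> \<bar>?c k x\<bar>" if "k \<in> A" for k
    using that fin by (simp add: t_def)
  have le_t: "\<bar>?c k x\<bar> \<le> t" if "k \<notin> A" for k
    using coeff_le_SUP[OF assms(1), of k "-A" x] that sup_le by (simp add: t_def)
  define y where "y = x - (\<Sum>n\<in>B. a n *\<^sub>R e n)"
  define z where "z = x - (\<Sum>n\<in>A \<union> B. ?c n x *\<^sub>R e n)"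
  define \<eta> where "\<eta> n = (if ?c n x < 0 then - 1 else 1 :: real)" for n
  have cy: "?c k y = ?c k x - (if k \<in> B then a k else 0)" for k
    using coeff_finite_sum[OF biorth assms(6)] by (simp add: y_def blinfun.diff_right)
  have cz: "?c k z = (if k \<in> A \<union> B then 0 else ?c k x)" for k
    using coeff_finite_sum[OF biorth, of "A \<union> B"] fin assms(6)
    by (simp add: z_def blinfun.diff_right)

  \<comment> \<open>Removing the common part of \<open>A\<close> and \<open>B\<close> preserves the comparison of weights.\<close>
  have weights: "sum w (B - A) \<le> sum w (A - B)"
    using assms(7) fin assms(6) sum.Int_Diff[of A w B] sum.Int_Diff[of B w A]
    by (simp add: Int_commute)

  have A_step: "norm (z + t *\<^sub>R sign_sum e \<epsilon> (B - A)) \<le> C * norm (z + t *\<^sub>R sign_sum e \<eta> (A - B))"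
    if "signs \<epsilon>" for \<epsilon>
  proof -
    have "(SUP j. \<bar>?c j z\<bar>) \<le> t"
      using le_t t_pos by (intro cSUP_least) (auto simp: cz)
    moreover have "supp es z \<inter> ((B - A) \<union> (A - B)) = {}" by (auto simp: supp_def cz)
    moreover have "signs \<eta>" by (simp add: signs_def \<eta>_def)
    moreover have "(B - A) \<inter> (A - B) = {}" "finite (B - A)" "finite (A - B)"
      using fin assms(6) by auto
    ultimately show ?thesis
      using assms(3) weights that unfolding w_property_A_with_def by blast
  qed

  \<comment> \<open>Shrinking the \<open>n\<close>-th coefficient of \<open>y\<close> by the factor \<open>1 - \<mu> n\<close> deletes everything on \<open>B\<close>,
    including the competitor's coefficients, and truncates those on \<open>A - B\<close> to modulus \<open>t\<close>.\<close>
  define \<mu> where "\<mu> n = (if n \<in> B then 1 else 1 - t / \<bar>?c n x\<bar>)" for n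
  have \<mu>_bounds: "0 \<le> \<mu> n \<and> \<mu> n \<le> 1" if "n \<in> A \<union> B" for n
  proof (cases "n \<in> B")
    case False
    then have "t \<le> \<bar>?c n x\<bar>" using that t_le by blast
    then show ?thesis using False t_pos by (auto simp: \<mu>_def)
  qed (simp add: \<mu>_def)
  have "z + t *\<^sub>R sign_sum e \<eta> (A - B) = y - (\<Sum>n\<in>A \<union> B. \<mu> n *\<^sub>R (?c n y *\<^sub>R e n))"
  proof -
    have split: "(\<Sum>n\<in>A \<union> B. g n) = (\<Sum>n\<in>A - B. g n) + (\<Sum>n\<in>B. g n)" for g :: "nat \<Rightarrow> 'a"
      using sum.union_disjoint[of "A - B" B g] fin assms(6)
      by (simp add: Un_commute Int_commute Diff_disjoint)
    have off_B: "\<mu> n *\<^sub>R (?c n y *\<^sub>R e n) = ?c n x *\<^sub>R e n - t *\<^sub>R (\<eta> n *\<^sub>R e n)" if "n \<in> A - B" for n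
    proof -
      have "?c n x \<noteq> 0" using that A_supp by (auto simp: supp_def)
      then have "\<mu> n * ?c n x = ?c n x - t * \<eta> n"
        using that by (auto simp: \<mu>_def \<eta>_def field_simps)
      then show ?thesis using that by (simp add: cy scaleR_left_diff_distrib)
    qed
    have on_B: "(\<Sum>n\<in>B. \<mu> n *\<^sub>R (?c n y *\<^sub>R e n)) = (\<Sum>n\<in>B. ?c n x *\<^sub>R e n) - (\<Sum>n\<in>B. a n *\<^sub>R e n)"
      by (simp add: \<mu>_def cy scaleR_left_diff_distrib sum_subtractf)
    have off: "(\<Sum>n\<in>A - B. \<mu> n *\<^sub>R (?c n y *\<^sub>R e n))
        = (\<Sum>n\<in>A - B. ?c n x *\<^sub>R e n) - t *\<^sub>R sign_sum e \<eta> (A - B)"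
      unfolding sign_sum_def scaleR_sum_right sum_subtractf[symmetric]
      by (rule sum.cong[OF refl off_B])
    have z_eq: "z = y - (\<Sum>n\<in>A - B. ?c n x *\<^sub>R e n)
        - ((\<Sum>n\<in>B. ?c n x *\<^sub>R e n) - (\<Sum>n\<in>B. a n *\<^sub>R e n))"
      by (simp add: y_def z_def split)
    show ?thesis unfolding split on_B off z_eq by (simp add: algebra_simps)
  qed
  then have K_step: "norm (z + t *\<^sub>R sign_sum e \<eta> (A - B)) \<le> K * norm y"
    using unconditional_with_multiplier[OF assms(2), of "A \<union> B" \<mu> y] \<mu>_bounds fin assms(6) by auto

  have "x - (\<Sum>n\<in>A. ?c n x *\<^sub>R e n) = z + (\<Sum>n\<in>B - A. ?c n x *\<^sub>R e n)"
  proof -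
    have "(\<Sum>n\<in>A \<union> B. ?c n x *\<^sub>R e n) = (\<Sum>n\<in>A. ?c n x *\<^sub>R e n) + (\<Sum>n\<in>B - A. ?c n x *\<^sub>R e n)"
      using sum.union_disjoint[of A "B - A"] fin assms(6) by (simp add: Diff_disjoint)
    then show ?thesis by (simp add: z_def)
  qed
  also have "norm \<dots> \<le> C * norm (z + t *\<^sub>R sign_sum e \<eta> (A - B))"
    using A_step le_t assms(6) by (intro norm_add_bounded_coeffs_le[of _ _ t]) auto
  also have "\<dots> \<le> C * (K * norm y)"
    using K_step assms(3) by (intro mult_left_mono) (auto simp: w_property_A_with_def)
  finally show ?thesis by (simp add: y_def mult_ac)
qed

lemma unconditional_with_property_A_with_imp_w_greedy_with:
  assumes "basis e es" "unconditional_with e es K" "w_property_A_with e es w C"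
  shows "w_greedy_with e es w (K * C)"
  unfolding w_greedy_with_def
proof (intro conjI allI impI)
  have K: "1 \<le> K" using unconditional_with_ge_1 assms(1,2) .
  have C: "1 \<le> C" using assms(3) by (simp add: w_property_A_with_def)
  show "1 \<le> K * C" using mult_mono[of 1 K 1 C] K C by simp
  then have KC: "0 < K * C" by simp
  fix x m A assume m: "1 \<le> m" and A: "greedy_set es x m A"
  then have fin: "finite A" by (simp add: greedy_set_def)
  have "norm (x - proj e es A x) / (K * C) \<le> sigma_w e w (sum w A) x"
    unfolding sigma_w_def
  proof (rule cInf_greatest)
    show "{norm (x - (\<Sum>n\<in>B. a n *\<^sub>R e n)) |B (a :: nat \<Rightarrow> real).
        finite B \<and> sum w B \<le> sum w A} \<noteq> {}"
      using fin by blast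
  next
    fix s
    assume "s \<in> {norm (x - (\<Sum>n\<in>B. a n *\<^sub>R e n)) |B (a :: nat \<Rightarrow> real).
        finite B \<and> sum w B \<le> sum w A}"
    then obtain B and a :: "nat \<Rightarrow> real"
      where B: "finite B" "sum w B \<le> sum w A" and s: "s = norm (x - (\<Sum>n\<in>B. a n *\<^sub>R e n))"
      by blast
    have "norm (x - proj e es A x) \<le> K * C * s"
      using greedy_competitor_bound[OF assms m A B, of a] proj_finite(2)[OF fin, of e es x]
      by (simp add: s)
    then show "norm (x - proj e es A x) / (K * C) \<le> s"
      using KC by (simp add: divide_le_eq mult.commute)
  qed
  then show "norm (x - proj e es A x) \<le> K * C * sigma_w e w (sum w A) x"
    using KC by (simp add: divide_le_eq mult.commute)
qed

theorem theorem2p1: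
  fixes e :: "nat \<Rightarrow> 'a::banach"
    and es :: "nat \<Rightarrow> 'a \<Rightarrow>\<^sub>L real"
    and w :: "nat \<Rightarrow> real"
  assumes "basis e es" and "weight w"
  shows "(w_greedy e es w \<longrightarrow>
            unconditional e es \<and> w_property_A e es w \<and>
            K_u e es \<le> C_g e es w \<and> C_a e es w \<le> C_g e es w) \<and>
         (unconditional e es \<and> w_property_A e es w \<longrightarrow>
            w_greedy e es w \<and> C_g e es w \<le> K_u e es * C_a e es w)"
proof (intro conjI[of "_ \<longrightarrow> _"] impI)
  assume "w_greedy e es w"
  then have G: "w_greedy_with e es w (C_g e es w)" by (rule C_g_least)
  have U: "unconditional_with e es (C_g e es w)"
    using w_greedy_with_imp_unconditional_with[OF assms(1) G] .
  have A: "w_property_A_with e es w (C_g e es w)"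
    using w_greedy_with_imp_w_property_A_with[OF assms G] .
  have "unconditional e es" using U by (auto simp: unconditional_def)
  moreover have "w_property_A e es w" using A by (auto simp: w_property_A_def)
  ultimately show "unconditional e es \<and> w_property_A e es w \<and>
      K_u e es \<le> C_g e es w \<and> C_a e es w \<le> C_g e es w"
    using K_u_least(2)[OF assms(1) _ U] C_a_least(2)[OF _ A] by blast
next
  assume UA: "unconditional e es \<and> w_property_A e es w"
  have G: "w_greedy_with e es w (K_u e es * C_a e es w)"
    using unconditional_with_property_A_with_imp_w_greedy_with[OF assms(1)]
      K_u_least(1)[OF assms(1)] C_a_least(1) UA by blast
  then have "w_greedy e es w" by (auto simp: w_greedy_def)
  then show "w_greedy e es w \<and> C_g e es w \<le> K_u e es * C_a e es w"
    using C_g_least(2)[OF _ G] by blast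
qed

end
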